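(* Let $\mathbf{x}_t = x_t^1\ldots x_t^i\ldots x_t^d$ and $\hat{\mathbf{x}}_t = x_t^1\ldots \hat{x}_t^i\ldots x_t^d$ be two sequences in $\mathcal{X}^d$ that differ only in position $i$, with $x_t^i = [\mathbf{M}]$ and $\hat{x}_t^i \neq [\mathbf{M}]$, and let $t$ be a time with $\bar\sigma(t)>0$ and $p_t(\mathbf{x}_t)>0$. Then, for the marginal distribution $p_t$ of the absorbing diffusion, $$\frac{p_t(x_t^1\ldots\hat{x}_t^i\ldots x_t^d)}{p_t(x_t^1\ldots x_t^i\ldots x_t^d)} = \frac{e^{-\bar\sigma(t)}}{1-e^{-\bar\sigma(t)}}\; p_0(\hat{x}_t^i \mid \mathbf{x}_t^{\mathrm{UM}}).$$
   Context: Let $\mathcal{X}=\{1,\ldots,N\}$ be a finite set of tokens whose last state $N$ is a special mask token denoted $[\mathbf{M}]$. The absorbing rate matrix $\mathbf{Q}^{\mathrm{absorb}}\in\mathbb{R}^{N\times N}$ has $\mathbf{Q}^{\mathrm{absorb}}(x,x)=-1$ and $\mathbf{Q}^{\mathrm{absorb}}(x,[\mathbf{M}])=1$ for every $x\neq[\mathbf{M}]$, and all other entries (in particular the whole row of $[\mathbf{M}]$) equal to $0$. The noise schedule is a nonnegative (locally integrable) function $\sigma(t)$, and $\bar\sigma(t)=\int_0^t\sigma(s)\,ds$. The initial ("clean data") distribution $p_0$ is a probability distribution on $\mathcal{X}^d$ supported on sequences containing no $[\mathbf{M}]$. The forward process $(\mathbf{x}_t)_{t\ge0}$ on $\mathcal{X}^d$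 starts from $\mathbf{x}_0\sim p_0$ and, conditionally on $\mathbf{x}_0$, its $d$ coordinates evolve independently, each as a time-inhomogeneous continuous-time Markov chain on $\mathcal{X}$ with transition rate matrix $\sigma(t)\mathbf{Q}^{\mathrm{absorb}}$, where $\mathbf{Q}_t(x,\hat{x})$ denotes the rate from state $x$ to state $\hat{x}$ at time $t$ (so the transition matrices $\mathbf{P}_{t|s}(x,\hat{x})=p_{t|s}(\hat{x}\mid x)$ satisfy $\frac{d}{dt}\mathbf{P}_{t|s}=\mathbf{P}_{t|s}\mathbf{Q}_t$). $p_t$ denotes the law of $\mathbf{x}_t$. For $\mathbf{x}\in\mathcal{X}^d$, $\mathbf{x}^{\mathrm{UM}}$ denotes the collection of all unmasked tokens of $\mathbf{x}$ together with their positions. $p_0(\mathbf{x}^{\mathrm{UM}})$ is the marginal probability under $p_0$ that the clean sequence agrees with $\mathbf{x}$ at all unmasked positions of $\mathbf{x}$ (equal to $1$ if there are none), and $p_0(\hat{x}^i\mid\mathbf{x}^{\mathrm{UM}})$ is the conditional probability under $p_0$ that the clean sequence has token $\hat{x}^i$ at position $i$, given that it agrees with $\mathbf{x}$ at all unmasked positions of $\mathbf{x}$. *)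

theory Defs
  imports "HOL-Probability.Probability"
begin

text \<open>Tokens are \<open>{1..N}\<close>, the last one \<open>N\<close> being the mask; positions are \<open>{1..d}\<close>.\<close>

definition seqs :: "nat \<Rightarrow> nat \<Rightarrow> (nat \<Rightarrow> nat) set" where
  "seqs N d = {1..d} \<rightarrow>\<^sub>E {1..N}"

definition Q_absorb :: "nat \<Rightarrow> nat \<Rightarrow> nat \<Rightarrow> real" where
  "Q_absorb N x y =
     (if x = N then 0 else if y = x then - 1 else if y = N then 1 else 0)"

definition noise_schedule :: "(real \<Rightarrow> real) \<Rightarrow> bool" where
  "noise_schedule \<sigma> \<longleftrightarrow>
     (\<forall>t\<ge>0. 0 \<le> \<sigma> t) \<and> (\<forall>T\<ge>0. \<sigma> absolutely_integrable_on {0..T})"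

definition sigma_bar :: "(real \<Rightarrow> real) \<Rightarrow> real \<Rightarrow> real" where
  "sigma_bar \<sigma> t = integral {0..t} \<sigma>"

text \<open>
  \<open>P s t x y\<close> is the probability of being in \<open>y\<close> at time \<open>t\<close> given \<open>x\<close> at time \<open>s\<close>, and
  \<open>R t x y\<close> is the rate from \<open>x\<close> to \<open>y\<close> at time \<open>t\<close>. As the rates are only locally integrable
  in time, the forward equation \<open>d/dt P = P R\<close> with \<open>P s s = I\<close> is read in its integrated
  (Caratheodory) form; the initial condition is the case \<open>s = t\<close>.
\<close>

definition transition_matrices ::
  "nat \<Rightarrow> (real \<Rightarrow> nat \<Rightarrow> nat \<Rightarrow> real) \<Rightarrow> (real \<Rightarrow> real \<Rightarrow> nat \<Rightarrow> nat \<Rightarrow> real) \<Rightarrow> bool" where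
  "transition_matrices N R P \<longleftrightarrow>
     (\<forall>s t. 0 \<le> s \<longrightarrow> s \<le> t \<longrightarrow> (\<forall>x\<in>{1..N}.
        (\<forall>y\<in>{1..N}. 0 \<le> P s t x y) \<and>
        (\<Sum>y\<in>{1..N}. P s t x y) = 1 \<and>
        (\<forall>y\<in>{1..N}.
          ((\<lambda>u. \<Sum>z\<in>{1..N}. P s u x z * R u z y)
             has_integral (P s t x y - (if x = y then 1 else 0))) {s..t})))"

text \<open>
  In the Markov property, \<open>H\<close> and \<open>h\<close> give an arbitrary finite history before \<open>s\<close>.
\<close>

definition ctmc ::
  "'w measure \<Rightarrow> nat \<Rightarrow> (real \<Rightarrow> nat \<Rightarrow> nat \<Rightarrow> real) \<Rightarrow> (real \<Rightarrow> 'w \<Rightarrow> nat) \<Rightarrow> bool" where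
  "ctmc M N R Y \<longleftrightarrow>
     prob_space M \<and>
     (\<forall>t\<ge>0. Y t \<in> measurable M (count_space {1..N})) \<and>
     (\<exists>P. transition_matrices N R P \<and>
       (\<forall>s t H h. \<forall>x\<in>{1..N}. \<forall>y\<in>{1..N}.
          0 \<le> s \<longrightarrow> s \<le> t \<longrightarrow> finite H \<longrightarrow> H \<subseteq> {0..<s} \<longrightarrow>
          \<P>(\<omega> in M. Y s \<omega> = x \<and> (\<forall>r\<in>H. Y r \<omega> = h r)) > 0 \<longrightarrow>
          \<P>(\<omega> in M. Y t \<omega> = y \<bar> Y s \<omega> = x \<and> (\<forall>r\<in>H. Y r \<omega> = h r)) = P s t x y))"

text \<open>
  The forward process. Conditioning on the clean sequence \<open>x0\<close> is the measure
  \<open>uniform_measure M {X 0 = x0}\<close>, i.e. \<open>B \<mapsto> M (B \<inter> {X 0 = x0}) / M {X 0 = x0}\<close>;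
  the coordinates are independent under it as whole processes on \<open>[0, \<infinity>)\<close>.
\<close>

definition absorbing_diffusion ::
  "'w measure \<Rightarrow> nat \<Rightarrow> nat \<Rightarrow> (real \<Rightarrow> real) \<Rightarrow> (nat \<Rightarrow> nat) pmf
     \<Rightarrow> (real \<Rightarrow> 'w \<Rightarrow> nat \<Rightarrow> nat) \<Rightarrow> bool" where
  "absorbing_diffusion M N d \<sigma> p0 X \<longleftrightarrow>
     prob_space M \<and>
     (\<forall>t\<ge>0. X t \<in> measurable M (count_space (seqs N d))) \<and>
     distr M (count_space UNIV) (X 0) = measure_pmf p0 \<and>
     (\<forall>x0\<in>set_pmf p0.
        let M' = uniform_measure M {\<omega> \<in> space M. X 0 \<omega> = x0} in
          prob_space.indep_vars M'
            (\<lambda>_. Pi\<^sub>M {0..} (\<lambda>_. count_space {1..N}))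
            (\<lambda>j \<omega>. \<lambda>t\<in>{0::real..}. X t \<omega> j) {1..d} \<and>
          (\<forall>j\<in>{1..d}. ctmc M' N (\<lambda>t x y. \<sigma> t * Q_absorb N x y) (\<lambda>t \<omega>. X t \<omega> j)))"

definition clean_distribution :: "nat \<Rightarrow> nat \<Rightarrow> (nat \<Rightarrow> nat) pmf \<Rightarrow> bool" where
  "clean_distribution N d p0 \<longleftrightarrow>
     set_pmf p0 \<subseteq> {x \<in> seqs N d. \<forall>j\<in>{1..d}. x j \<noteq> N}"

definition marginal :: "'w measure \<Rightarrow> (real \<Rightarrow> 'w \<Rightarrow> nat \<Rightarrow> nat) \<Rightarrow> real \<Rightarrow> (nat \<Rightarrow> nat) \<Rightarrow> real" where
  "marginal M X t x = \<P>(\<omega> in M. X t \<omega> = x)"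

definition agrees_UM :: "nat \<Rightarrow> nat \<Rightarrow> (nat \<Rightarrow> nat) \<Rightarrow> (nat \<Rightarrow> nat) \<Rightarrow> bool" where
  "agrees_UM N d x z \<longleftrightarrow> (\<forall>j\<in>{1..d}. x j \<noteq> N \<longrightarrow> z j = x j)"

definition clean_cond :: "nat \<Rightarrow> nat \<Rightarrow> (nat \<Rightarrow> nat) pmf \<Rightarrow> nat \<Rightarrow> nat \<Rightarrow> (nat \<Rightarrow> nat) \<Rightarrow> real" where
  "clean_cond N d p0 i a x = \<P>(z in measure_pmf p0. z i = a \<bar> agrees_UM N d x z)"

end

theory Submission
  imports Defs
begin

text \<open>
  Given the clean sequence, the coordinates are independent, and each keeps its token with
  probability \<open>e = exp (- sigma_bar \<sigma> t)\<close> and is masked otherwise. Hence \<open>p\<^sub>t(y)\<close> is the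
  probability under \<open>p\<^sub>0\<close> of agreeing with the unmasked part of \<open>y\<close>, times a factor \<open>1 - e\<close> per
  masked and \<open>e\<close> per unmasked position of \<open>y\<close>; in the quotient all factors but the one at \<open>i\<close> cancel.
\<close>

section \<open>A scalar integral equation with integrable rate\<close>

text \<open>
  As \<open>\<sigma>\<close> is only integrable, \<open>p\<close> is not differentiated. Instead, \<open>p\<close> is antitone, so over a step on
  which \<open>S = \<integral>\<sigma>\<close> grows by \<open>h\<close> the ratio of its values lies between \<open>1 - h\<close> and \<open>1 / (1 + h)\<close>. Cutting
  \<open>[0, t]\<close> into \<open>n\<close> pieces of equal growth \<open>S t / n\<close> (intermediate value theorem) and letting
  \<open>n \<rightarrow> \<infinity>\<close> gives \<open>exp (- S t)\<close> from both sides.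
\<close>

lemma exp_decay_of_integral_equation:
  fixes \<sigma> p :: "real \<Rightarrow> real"
  assumes \<sigma>0: "\<And>u. 0 \<le> u \<Longrightarrow> 0 \<le> \<sigma> u"
    and \<sigma>int: "\<And>T. 0 \<le> T \<Longrightarrow> \<sigma> integrable_on {0..T}"
    and p0: "\<And>u. 0 \<le> u \<Longrightarrow> 0 \<le> p u"
    and eq: "\<And>u. 0 \<le> u \<Longrightarrow> ((\<lambda>r. \<sigma> r * p r) has_integral (1 - p u)) {0..u}"
    and t: "0 \<le> t"
  shows "p t = exp (- integral {0..t} \<sigma>)"
proof -
  define S where "S u = integral {0..u} \<sigma>" for u
  have eq': "((\<lambda>r. \<sigma> r * p r) has_integral (p u - p v)) {u..v}" if "0 \<le> u" "u \<le> v" for u v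
  proof -
    have "(\<lambda>r. \<sigma> r * p r) integrable_on {0..v}"
      using eq[of v] that by (auto intro: has_integral_integrable)
    moreover from this have "(\<lambda>r. \<sigma> r * p r) integrable_on {u..v}"
      by (rule integrable_on_subinterval) (use that in auto)
    moreover have "integral {0..u} (\<lambda>r. \<sigma> r * p r) = 1 - p u"
      "integral {0..v} (\<lambda>r. \<sigma> r * p r) = 1 - p v"
      using eq that by (auto intro!: integral_unique)
    moreover have "integral {0..u} (\<lambda>r. \<sigma> r * p r) + integral {u..v} (\<lambda>r. \<sigma> r * p r)
        = integral {0..v} (\<lambda>r. \<sigma> r * p r)"
      using that calculation by (intro Henstock_Kurzweil_Integration.integral_combine) auto
    ultimately show ?thesis
      by (simp add: has_integral_iff)
  qed
  have S': "(\<sigma> has_integral (S v - S u)) {u..v}" if "0 \<le> u" "u \<le> v" for u v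
  proof -
    have "\<sigma> integrable_on {u..v}"
      using \<sigma>int[of v] by (rule integrable_on_subinterval) (use that in auto)
    moreover have "S u + integral {u..v} \<sigma> = S v"
      unfolding S_def
      using that \<sigma>int[of v] by (intro Henstock_Kurzweil_Integration.integral_combine) auto
    ultimately show ?thesis
      by (simp add: has_integral_iff)
  qed
  have anti: "p v \<le> p u" if "0 \<le> u" "u \<le> v" for u v
    using has_integral_nonneg[OF eq'[OF that]] that \<sigma>0 p0 by auto
  \<comment> \<open>Since \<open>p\<close> is antitone, \<open>p r\<close> \<ge> \<open>p v\<close>
    on \<open>{u..v}\<close>, so the loss \<open>p u - p v\<close> is at least
    \<open>(S v - S u) * p v\<close>. For \<open>lower\<close>, \<open>p r\<close> \<le>
    \<open>p u\<close> bounds the same loss from above.\<close>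
  have upper: "p v * (1 + (S v - S u)) \<le> p u" if "0 \<le> u" "u \<le> v" for u v
  proof -
    have "(S v - S u) * p v \<le> p u - p v"
      by (rule has_integral_le[OF has_integral_mult_left[OF S'[OF that]] eq'[OF that]])
        (use that \<sigma>0 anti in \<open>auto intro!: mult_left_mono\<close>)
    then show ?thesis by (simp add: algebra_simps)
  qed
  have lower: "p u * (1 - (S v - S u)) \<le> p v" if "0 \<le> u" "u \<le> v" for u v
  proof -
    have "p u - p v \<le> (S v - S u) * p u"
      by (rule has_integral_le[OF eq'[OF that] has_integral_mult_left[OF S'[OF that]]])
        (use that \<sigma>0 anti in \<open>auto intro!: mult_left_mono\<close>)
    then show ?thesis by (simp add: algebra_simps)
  qed
  have Smono: "S u \<le> S v" if "0 \<le> u" "u \<le> v" for u v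
    using has_integral_nonneg[OF S'[OF that]] that \<sigma>0 by auto
  have Scont: "continuous_on {0..t} S"
    unfolding S_def by (rule indefinite_integral_continuous_1) (use \<sigma>int t in auto)
  have S0: "S 0 = 0" by (simp add: S_def)
  have p_0: "p 0 = 1" using eq[of 0] by (simp add: has_integral_refl has_integral_iff)
  have St: "0 \<le> S t" using Smono[of 0 t] S0 t by simp
  have steps: "(1 - h) ^ k \<le> p v \<and> p v * (1 + h) ^ k \<le> 1"
    if h: "0 < h" "h \<le> 1" and v: "0 \<le> v" "v \<le> t" "S v = real k * h" for h k v
    using v
  proof (induction k arbitrary: v)
    case 0
    \<comment> \<open>\<open>S v = 0\<close> does not force \<open>v = 0\<close>, as \<sigma> may
      vanish near 0; but growth zero on \<open>{0..v}\<close> makes both bounds collapse to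
      \<open>p v = 1\<close>.\<close>
    then show ?case using upper[of 0 v] lower[of 0 v] S0 p_0 by simp
  next
    case (Suc k)
    \<comment> \<open>The previous cutting point: \<open>real k * h\<close> lies between
      \<open>S 0 = 0\<close> and \<open>S v\<close>, and \<open>S\<close> is continuous.\<close>
    have "\<exists>u\<ge>0. u \<le> v \<and> S u = real k * h"
    proof (rule IVT')
      show "continuous_on {0..v} S"
        using Scont by (rule continuous_on_subset) (use Suc.prems in auto)
    qed (use Suc.prems S0 h in \<open>auto simp: algebra_simps\<close>)
    then obtain u where u: "0 \<le> u" "u \<le> v" "S u = real k * h" by blast
    have IH: "(1 - h) ^ k \<le> p u" "p u * (1 + h) ^ k \<le> 1"
      using Suc.IH[of u] u Suc.prems by auto
    have d: "S v - S u = h" using u Suc.prems by (simp add: algebra_simps)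
    have "(1 - h) ^ Suc k \<le> p u * (1 - h)"
      using mult_right_mono[OF IH(1), of "1 - h"] h by (simp add: mult.commute)
    also have "\<dots> \<le> p v" using lower[OF u(1,2)] d by simp
    finally have "(1 - h) ^ Suc k \<le> p v" .
    moreover have "p v * (1 + h) ^ Suc k \<le> p u * (1 + h) ^ k"
      using mult_right_mono[OF upper[OF u(1,2)], of "(1 + h) ^ k"] d h
      by (simp add: algebra_simps)
    with IH(2) have "p v * (1 + h) ^ Suc k \<le> 1" by linarith
    ultimately show ?case by blast
  qed
  show ?thesis
  \<comment> \<open>The step width \<open>S t / n\<close> must be positive in \<open>steps\<close>,
    so zero growth is treated apart.\<close>
  proof (cases "S t = 0")
    case True
    then show ?thesis
      using upper[of 0 t] lower[of 0 t] S0 p_0 t by (simp add: S_def)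
  next
    case False
    with St have pos: "0 < S t" by simp
    \<comment> \<open>From \<open>n0\<close> on, the width \<open>S t / n\<close> is at most 1,
      which keeps the factor \<open>1 - h\<close> nonnegative.\<close>
    obtain n0 :: nat where n0: "S t \<le> real n0" using real_arch_simple by blast
    have ev: "\<forall>\<^sub>F n in sequentially. (1 + (- S t) / real n) ^ n \<le> p t \<and> p t * (1 + S t / real n) ^ n \<le> 1"
      using eventually_ge_at_top[of "max n0 1"]
    proof eventually_elim
      case (elim n)
      with n0 have "S t \<le> real n" "0 < real n" by auto
      with steps[of "S t / real n" t n] pos t show ?case by (simp add: field_simps)
    qed
    have "exp (- S t) \<le> p t"
      by (rule tendsto_upperbound[OF tendsto_exp_limit_sequentially])
        (use ev in \<open>auto elim: eventually_mono\<close>)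
    moreover have "p t * exp (S t) \<le> 1"
      by (rule tendsto_upperbound[OF tendsto_mult[OF tendsto_const tendsto_exp_limit_sequentially]])
        (use ev in \<open>auto elim: eventually_mono\<close>)
    ultimately have "p t = exp (- S t)"
      by (simp add: exp_minus field_simps)
    then show ?thesis by (simp add: S_def)
  qed
qed

section \<open>Transition probabilities of one coordinate\<close>

text \<open>A column of \<open>Q_absorb\<close> other than that of the mask has only its diagonal
  entry -1, so the forward equation decouples into one scalar equation per unmasked target. The mask
  receives the remaining mass.\<close>

lemma absorbing_transition:
  assumes \<sigma>: "noise_schedule \<sigma>"
    and P: "transition_matrices N (\<lambda>t x y. \<sigma> t * Q_absorb N x y) P"
    and a: "a \<in> {1..N}" "a \<noteq> N" and b: "b \<in> {1..N}" and t: "0 \<le> t"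
  shows "P 0 t a b = (if b = N then 1 - exp (- sigma_bar \<sigma> t)
                      else if a = b then exp (- sigma_bar \<sigma> t) else 0)"
proof -
  have nonneg: "0 \<le> P 0 u a y" if "0 \<le> u" "y \<in> {1..N}" for u y
    using P a that unfolding transition_matrices_def by blast
  have total: "(\<Sum>y\<in>{1..N}. P 0 t a y) = 1"
    using P a t unfolding transition_matrices_def by blast
  have eq: "((\<lambda>r. \<sigma> r * P 0 r a y) has_integral ((if a = y then 1 else 0) - P 0 u a y)) {0..u}"
    if u: "0 \<le> u" and y: "y \<in> {1..N}" "y \<noteq> N" for u y
  proof -
    have "((\<lambda>r. \<Sum>z\<in>{1..N}. P 0 r a z * (\<sigma> r * Q_absorb N z y))
        has_integral (P 0 u a y - (if a = y then 1 else 0))) {0..u}"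
      using P a u y unfolding transition_matrices_def by blast
    moreover have "(\<Sum>z\<in>{1..N}. P 0 r a z * (\<sigma> r * Q_absorb N z y)) = - (\<sigma> r * P 0 r a y)" for r
    proof -
      have "(\<Sum>z\<in>{1..N}. P 0 r a z * (\<sigma> r * Q_absorb N z y))
          = (\<Sum>z\<in>{1..N}. if y = z then - (\<sigma> r * P 0 r a y) else 0)"
        using y by (intro sum.cong) (auto simp: Q_absorb_def)
      then show ?thesis using y by simp
    qed
    ultimately have "((\<lambda>r. - (\<sigma> r * P 0 r a y))
        has_integral (P 0 u a y - (if a = y then 1 else 0))) {0..u}" by simp
    from has_integral_neg[OF this] show ?thesis by simp
  qed
  have other: "P 0 t a y = 0" if "y \<in> {1..N}" "y \<noteq> N" "y \<noteq> a" for y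
  proof -
    \<comment> \<open>Starting at 0, the probability equals minus an integral of a nonnegative
      function, so it cannot become positive.\<close>
    have "0 \<le> (if a = y then 1 else 0) - P 0 t a y"
      by (rule has_integral_nonneg[OF eq[OF t that(1,2)]])
        (use that \<sigma> nonneg in \<open>auto simp: noise_schedule_def\<close>)
    with nonneg[OF t that(1)] that(3) show ?thesis by simp
  qed
  have same: "P 0 t a a = exp (- sigma_bar \<sigma> t)"
    unfolding sigma_bar_def
  proof (rule exp_decay_of_integral_equation[where p = "\<lambda>u. P 0 u a a"])
    show "\<sigma> integrable_on {0..T}" if "0 \<le> T" for T
      using \<sigma> that unfolding noise_schedule_def
      by (blast intro: set_lebesgue_integral_eq_integral(1))
  qed (use \<sigma> nonneg a t eq[of _ a] in \<open>auto simp: noise_schedule_def\<close>)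
  have "(\<Sum>y\<in>{1..N}. P 0 t a y) = (\<Sum>y\<in>{a, N}. P 0 t a y)"
    using a other by (intro sum.mono_neutral_right) auto
  then have "P 0 t a N = 1 - exp (- sigma_bar \<sigma> t)"
    using total same a by simp
  then show ?thesis using same other b by auto
qed

text \<open>The Markov property at time 0 with empty history; conditioning on the start changes
  nothing because that event has probability 1.\<close>

lemma ctmc_absorb_law:
  assumes \<sigma>: "noise_schedule \<sigma>"
    and Y: "ctmc M N (\<lambda>t x y. \<sigma> t * Q_absorb N x y) Y"
    and start: "AE \<omega> in M. Y 0 \<omega> = a"
    and a: "a \<in> {1..N}" "a \<noteq> N" and b: "b \<in> {1..N}" and t: "0 \<le> t"
  shows "\<P>(\<omega> in M. Y t \<omega> = b) = (if b = N then 1 - exp (- sigma_bar \<sigma> t)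
                      else if a = b then exp (- sigma_bar \<sigma> t) else 0)"
proof -
  interpret prob_space M using Y unfolding ctmc_def by (rule conjunct1)
  obtain P where P: "transition_matrices N (\<lambda>t x y. \<sigma> t * Q_absorb N x y) P"
    and markov: "\<forall>s t H h. \<forall>x\<in>{1..N}. \<forall>y\<in>{1..N}.
          0 \<le> s \<longrightarrow> s \<le> t \<longrightarrow> finite H \<longrightarrow> H \<subseteq> {0..<s} \<longrightarrow>
          \<P>(\<omega> in M. Y s \<omega> = x \<and> (\<forall>r\<in>H. Y r \<omega> = h r)) > 0 \<longrightarrow>
          \<P>(\<omega> in M. Y t \<omega> = y \<bar> Y s \<omega> = x \<and> (\<forall>r\<in>H. Y r \<omega> = h r)) = P s t x y"
    using Y unfolding ctmc_def by (elim conjE exE) (rule that)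
  have [measurable]: "Y u \<in> measurable M (count_space {1..N})" if "0 \<le> u" for u
    using Y that unfolding ctmc_def by (elim conjE) simp
  have m0[measurable]: "{\<omega> \<in> space M. Y 0 \<omega> = a} \<in> sets M"
    by measurable
  have mt[measurable]: "{\<omega> \<in> space M. Y t \<omega> = b} \<in> sets M"
    using t by measurable
  have "{\<omega> \<in> space M. Y t \<omega> = b \<and> Y 0 \<omega> = a}
      = {\<omega> \<in> space M. Y t \<omega> = b} \<inter> {\<omega> \<in> space M. Y 0 \<omega> = a}" by auto
  then have mt0: "{\<omega> \<in> space M. Y t \<omega> = b \<and> Y 0 \<omega> = a} \<in> sets M"
    using m0 mt by auto
  have one: "\<P>(\<omega> in M. Y 0 \<omega> = a) = 1"
    using start m0 by (simp add: prob_Collect_eq_1)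
  have "\<P>(\<omega> in M. Y t \<omega> = b \<and> Y 0 \<omega> = a) = \<P>(\<omega> in M. Y t \<omega> = b)"
    by (rule finite_measure_eq_AE) (use start mt mt0 in auto)
  then have "\<P>(\<omega> in M. Y t \<omega> = b) = P 0 t a b"
    using markov[rule_format, where s = 0 and t = t and H = "{}" and x = a and y = b] a b t one
    by (simp add: cond_prob_def)
  with absorbing_transition[OF \<sigma> P a b t] show ?thesis by simp
qed

section \<open>The law of the whole sequence\<close>

lemma finite_seqs: "finite (seqs N d)"
  unfolding seqs_def by (intro finite_PiE) auto

text \<open>Under the conditional measure \<open>M'\<close> the coordinates are independent chains
  started at \<open>z j\<close>, so the probability of \<open>y\<close> is a product of
  one-coordinate laws. Multiplying by the probability \<open>pmf p0 z\<close> of the condition gives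
  the joint probability.\<close>

lemma conditional_marginal:
  assumes \<sigma>: "noise_schedule \<sigma>" and clean: "clean_distribution N d p0"
    and X: "absorbing_diffusion M N d \<sigma> p0 X"
    and y: "y \<in> seqs N d" and t: "0 \<le> t" and z: "z \<in> set_pmf p0"
  defines "e \<equiv> exp (- sigma_bar \<sigma> t)"
  shows "\<P>(\<omega> in M. X t \<omega> = y \<and> X 0 \<omega> = z)
    = pmf p0 z * ((\<Prod>j\<in>{1..d}. if y j = N then 1 - e else e)
                  * indicator {z. agrees_UM N d y z} z)"
proof -
  interpret prob_space M using X by (simp add: absorbing_diffusion_def)
  have meas[measurable]: "X u \<in> measurable M (count_space (seqs N d))" if "0 \<le> u" for u
    using X that by (simp add: absorbing_diffusion_def)
  define A where "A = {\<omega> \<in> space M. X 0 \<omega> = z}"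
  define M' where "M' = uniform_measure M A"
  have A[measurable]: "A \<in> sets M" unfolding A_def by measurable
  have zs: "z \<in> seqs N d" "\<And>j. j \<in> {1..d} \<Longrightarrow> z j \<noteq> N"
    using clean z unfolding clean_distribution_def by blast+
  have "X 0 \<in> measurable M (count_space UNIV)"
    using measurable_compose[OF meas[of 0] measurable_count_space[of "\<lambda>x. x"]] by simp
  then have "measure (distr M (count_space UNIV) (X 0)) {z} = measure M A"
    by (subst measure_distr) (auto simp: A_def vimage_def Int_def intro!: arg_cong[where f = "measure M"])
  then have pA: "measure M A = pmf p0 z"
    using X by (simp add: absorbing_diffusion_def pmf.rep_eq)
  then have posA: "0 < measure M A" using z by (simp add: pmf_positive)
  then have eA: "emeasure M A \<noteq> 0" "emeasure M A \<noteq> \<infinity>"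
    by (auto simp: emeasure_eq_measure)
  interpret M': prob_space M'
    unfolding M'_def by (rule prob_space_uniform_measure) (use eA in auto)
  have sp: "space M' = space M" "sets M' = sets M" by (auto simp: M'_def)
  have ind: "M'.indep_vars (\<lambda>_. Pi\<^sub>M {0..} (\<lambda>_. count_space {1..N}))
            (\<lambda>j \<omega>. \<lambda>t\<in>{0::real..}. X t \<omega> j) {1..d}"
    and ct: "\<And>j. j \<in> {1..d} \<Longrightarrow> ctmc M' N (\<lambda>t x y. \<sigma> t * Q_absorb N x y) (\<lambda>t \<omega>. X t \<omega> j)"
    using X z unfolding absorbing_diffusion_def M'_def A_def Let_def by blast+
  \<comment> \<open>Independence of whole paths passes to their values at time \<open>t\<close>,
    evaluation being measurable.\<close>
  have "M'.indep_vars (\<lambda>_. count_space {1..N})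
      (\<lambda>j \<omega>. (\<lambda>f. f t) ((\<lambda>j \<omega>. \<lambda>t\<in>{0::real..}. X t \<omega> j) j \<omega>)) {1..d}"
    using ind by (rule M'.indep_vars_compose2) (use t in \<open>auto intro: measurable_component_singleton\<close>)
  then have ind': "M'.indep_vars (\<lambda>_. count_space {1..N}) (\<lambda>j \<omega>. X t \<omega> j) {1..d}"
    using t by simp
  have startAE: "AE \<omega> in M'. X 0 \<omega> j = z j" for j
    unfolding M'_def by (rule AE_uniform_measureI) (auto simp: A_def)
  have yN: "y j \<in> {1..N}" "z j \<in> {1..N}" if "j \<in> {1..d}" for j
    using y zs that by (auto simp: seqs_def)
  have mt: "{\<omega> \<in> space M. X t \<omega> = y} \<in> sets M" using t by measurable
  have Xs: "X t \<omega> \<in> seqs N d" if "\<omega> \<in> space M" for \<omega>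
    using measurable_space[OF meas[OF t] that] by simp
  have coord: "X t \<omega> = y \<longleftrightarrow> (\<forall>j\<in>{1..d}. X t \<omega> j \<in> {y j})" if "\<omega> \<in> space M" for \<omega>
    using Xs[OF that] y by (auto simp: seqs_def intro: PiE_ext)
  have "measure M' {\<omega> \<in> space M. X t \<omega> = y}
      = (\<Prod>j\<in>{1..d}. measure M' {\<omega> \<in> space M. X t \<omega> j = y j})"
  \<comment> \<open>The product rule for independent variables needs a nonempty index set; for
    \<open>d = 0\<close> both sides are 1.\<close>
  proof (cases "d = 0")
    case True
    then have "{\<omega> \<in> space M. X t \<omega> = y} = space M'"
      using coord sp by auto
    then show ?thesis using True M'.prob_space by simp
  next
    case False
    have "{\<omega> \<in> space M. X t \<omega> = y} = (\<Inter>j\<in>{1..d}. (\<lambda>\<omega>. X t \<omega> j) -` {y j} \<inter> space M')"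
      using coord sp False by auto
    moreover have "measure M' (\<Inter>j\<in>{1..d}. (\<lambda>\<omega>. X t \<omega> j) -` {y j} \<inter> space M')
      = (\<Prod>j\<in>{1..d}. measure M' ((\<lambda>\<omega>. X t \<omega> j) -` {y j} \<inter> space M'))"
      by (rule M'.indep_varsD[OF ind']) (use False yN in auto)
    ultimately show ?thesis
      by (simp add: sp vimage_def Int_def conj_commute)
  qed
  \<comment> \<open>Each law splits into a weight depending on \<open>y\<close> alone and a 0/1
    factor; the latter multiply to the indicator of agreement.\<close>
  also have "\<dots> = (\<Prod>j\<in>{1..d}. (if y j = N then 1 - e else e) * (if y j = N \<or> z j = y j then 1 else 0))"
  proof (rule prod.cong)
    fix j assume j: "j \<in> {1..d}"
    show "measure M' {\<omega> \<in> space M. X t \<omega> j = y j}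
      = (if y j = N then 1 - e else e) * (if y j = N \<or> z j = y j then 1 else 0)"
      using ctmc_absorb_law[OF \<sigma> ct[OF j] startAE yN(2)[OF j] zs(2)[OF j] yN(1)[OF j] t]
      by (auto simp: sp e_def)
  qed simp
  also have "\<dots> = (\<Prod>j\<in>{1..d}. if y j = N then 1 - e else e)
      * indicator {z. agrees_UM N d y z} z"
    unfolding prod.distrib
    by (auto simp: agrees_UM_def indicator_def intro!: prod.neutral)
  finally have "measure M' {\<omega> \<in> space M. X t \<omega> = y} = \<dots>" .
  moreover have "measure M' {\<omega> \<in> space M. X t \<omega> = y}
      = measure M (A \<inter> {\<omega> \<in> space M. X t \<omega> = y}) / measure M A"
    unfolding M'_def using mt A eA by (intro measure_uniform_measure) auto
  moreover have "A \<inter> {\<omega> \<in> space M. X t \<omega> = y} = {\<omega> \<in> space M. X t \<omega> = y \<and> X 0 \<omega> = z}"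
    by (auto simp: A_def)
  ultimately show ?thesis using pA posA by (simp add: field_simps)
qed

text \<open>Total probability over the finitely many clean sequences: the weight does not depend on
  \<open>z\<close> and leaves the sum.\<close>

lemma marginal_eq:
  assumes \<sigma>: "noise_schedule \<sigma>" and clean: "clean_distribution N d p0"
    and X: "absorbing_diffusion M N d \<sigma> p0 X"
    and y: "y \<in> seqs N d" and t: "0 \<le> t"
  defines "e \<equiv> exp (- sigma_bar \<sigma> t)"
  shows "marginal M X t y = (\<Prod>j\<in>{1..d}. if y j = N then 1 - e else e)
           * measure (measure_pmf p0) {z. agrees_UM N d y z}"
proof -
  interpret prob_space M using X by (simp add: absorbing_diffusion_def)
  have meas[measurable]: "X u \<in> measurable M (count_space (seqs N d))" if "0 \<le> u" for u
    using X that by (simp add: absorbing_diffusion_def)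
  have fin: "finite (set_pmf p0)"
    using clean finite_seqs by (auto simp: clean_distribution_def intro: finite_subset)
  have mt: "{\<omega> \<in> space M. X t \<omega> = y} \<in> sets M" using t by measurable
  have m0: "{\<omega> \<in> space M. X 0 \<omega> = z} \<in> sets M" for z by measurable
  have m: "{\<omega> \<in> space M. X t \<omega> = y \<and> X 0 \<omega> = z} \<in> sets M" for z
    using sets.Int[OF mt m0[of z]] by (simp add: Int_def conj_ac)
  have "X 0 \<in> measurable M (count_space UNIV)"
    using measurable_compose[OF meas[of 0] measurable_count_space[of "\<lambda>x. x"]] by simp
  moreover have "AE z in distr M (count_space UNIV) (X 0). z \<in> set_pmf p0"
  proof -
    have "distr M (count_space UNIV) (X 0) = measure_pmf p0"
      using X unfolding absorbing_diffusion_def by (elim conjE)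
    show ?thesis
      unfolding \<open>distr _ _ _ = _\<close> by (rule AE_measure_pmf)
  qed
  ultimately have start: "AE \<omega> in M. X 0 \<omega> \<in> set_pmf p0"
    by (auto simp: AE_distr_iff)
  \<comment> \<open>The union exhausts the event only up to a null set, where \<open>X 0\<close>
    lies outside the support.\<close>
  have "marginal M X t y = measure M (\<Union>z\<in>set_pmf p0. {\<omega> \<in> space M. X t \<omega> = y \<and> X 0 \<omega> = z})"
    unfolding marginal_def
    by (rule finite_measure_eq_AE) (use start m mt fin in auto)
  also have "\<dots> = (\<Sum>z\<in>set_pmf p0. \<P>(\<omega> in M. X t \<omega> = y \<and> X 0 \<omega> = z))"
    by (rule finite_measure_finite_Union) (use fin m in \<open>auto simp: disjoint_family_on_def\<close>)
  also have "\<dots> = (\<Sum>z\<in>set_pmf p0. pmf p0 z * ((\<Prod>j\<in>{1..d}. if y j = N then 1 - e else e)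
                  * indicator {z. agrees_UM N d y z} z))"
    unfolding e_def by (intro sum.cong refl conditional_marginal assms)
  also have "\<dots> = (\<Prod>j\<in>{1..d}. if y j = N then 1 - e else e)
      * (\<Sum>z\<in>set_pmf p0. pmf p0 z * indicator {z. agrees_UM N d y z} z)"
    unfolding sum_distrib_left by (intro sum.cong refl mult.left_commute)
  also have "(\<Sum>z\<in>set_pmf p0. pmf p0 z * indicator {z. agrees_UM N d y z} z)
      = measure (measure_pmf p0) {z. agrees_UM N d y z}"
  proof -
    have "measure (measure_pmf p0) {z. agrees_UM N d y z}
        = (\<integral>z. indicator {z. agrees_UM N d y z} z \<partial>measure_pmf p0)" by simp
    also have "\<dots> = (\<Sum>z\<in>set_pmf p0. indicator {z. agrees_UM N d y z} z * pmf p0 z)"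
      by (rule integral_measure_pmf_real) (use fin in auto)
    finally show ?thesis by (simp add: mult.commute)
  qed
  finally show ?thesis .
qed

section \<open>The ratio of the two marginals\<close>

theorem theorem1:
  fixes M :: "'w measure"
    and X :: "real \<Rightarrow> 'w \<Rightarrow> nat \<Rightarrow> nat"
    and N d i :: nat
    and \<sigma> :: "real \<Rightarrow> real"
    and p0 :: "(nat \<Rightarrow> nat) pmf"
    and x xh :: "nat \<Rightarrow> nat"
    and t :: real
  assumes "noise_schedule \<sigma>"
    and "clean_distribution N d p0"
    and "absorbing_diffusion M N d \<sigma> p0 X"
    and "x \<in> seqs N d" and "xh \<in> seqs N d"
    and "i \<in> {1..d}"
    and "\<forall>j\<in>{1..d}. j \<noteq> i \<longrightarrow> xh j = x j"
    and "x i = N" and "xh i \<noteq> N"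
    and "0 \<le> t" and "sigma_bar \<sigma> t > 0"
    and "marginal M X t x > 0"
  shows "marginal M X t xh / marginal M X t x
         = exp (- sigma_bar \<sigma> t) / (1 - exp (- sigma_bar \<sigma> t)) * clean_cond N d p0 i (xh i) x"
proof -
  define e where "e = exp (- sigma_bar \<sigma> t)"
  define w where "w y j = (if y j = N then 1 - e else e)" for y :: "nat \<Rightarrow> nat" and j
  \<comment> \<open>The weight of the positions other than \<open>i\<close>, common to
    \<open>x\<close> and \<open>xh\<close>; it is positive and hence cancels.\<close>
  define W where "W = (\<Prod>j\<in>{1..d} - {i}. w x j)"
  have e: "0 < e" "e < 1" using \<open>sigma_bar \<sigma> t > 0\<close> by (auto simp: e_def)
  have W: "W > 0" unfolding W_def using e by (intro prod_pos) (auto simp: w_def)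
  have "(\<Prod>j\<in>{1..d}. w x j) = w x i * W"
    unfolding W_def using \<open>i \<in> {1..d}\<close> by (intro prod.remove) auto
  then have mx: "marginal M X t x = (1 - e) * W * \<P>(z in measure_pmf p0. agrees_UM N d x z)"
    using marginal_eq[OF assms(1-4,10), folded e_def, folded w_def] \<open>x i = N\<close> by (simp add: w_def[of x i])
  have "(\<Prod>j\<in>{1..d}. w xh j) = w xh i * (\<Prod>j\<in>{1..d} - {i}. w xh j)"
    using \<open>i \<in> {1..d}\<close> by (intro prod.remove) auto
  also have "(\<Prod>j\<in>{1..d} - {i}. w xh j) = W"
    unfolding W_def using assms(7) by (intro prod.cong) (auto simp: w_def)
  finally have "marginal M X t xh = e * W * \<P>(z in measure_pmf p0. agrees_UM N d xh z)"
    using marginal_eq[OF assms(1-3,5,10), folded e_def, folded w_def] \<open>xh i \<noteq> N\<close> by (simp add: w_def[of xh i])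
  \<comment> \<open>As \<open>x i\<close> is masked, \<open>x\<close> puts no constraint on
    \<open>z i\<close>; unmasking \<open>i\<close> adds exactly one, which makes the quotient a
    conditional probability.\<close>
  also have "(\<lambda>z. agrees_UM N d xh z) = (\<lambda>z. z i = xh i \<and> agrees_UM N d x z)"
    using assms(6-9) by (intro ext) (auto simp: agrees_UM_def)
  finally have "marginal M X t xh
      = e * W * \<P>(z in measure_pmf p0. z i = xh i \<and> agrees_UM N d x z)" .
  with mx W e show ?thesis
    by (simp add: clean_cond_def cond_prob_def e_def[symmetric])
qed

end
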